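(* Let $q=p^m$ with $p$ prime and $m\in\mathbb{N}$, and let $k\in\mathbb{N}$ such that $k\mid q-1$. Then the generalized Paley graph $\Gamma(k,q)$ is integral if and only if $k$ divides $\frac{q-1}{p-1}$; more precisely, $$\mathrm{Spec}(\Gamma(k,q))\subset\mathbb{Z}\quad\Leftrightarrow\quad k\mid\tfrac{q-1}{p-1}\quad\Leftrightarrow\quad\eta_i^{(k,q)}\in\mathbb{Z}\ \text{ for all } 0\le i\le k-1.$$ In particular, no directed generalized Paley graph is integral.
   Context: For $k\mid q-1$, the generalized Paley graph $\Gamma(k,q)$ is the Cayley (di)graph with vertex set $\mathbb{F}_q$ and a directed edge from $u$ to $v$ iff $v-u\in R_k=\{x^k:x\in\mathbb{F}_q^*\}$. It is undirected iff $q$ is even, or $q$ is odd and $k\mid\frac{q-1}{2}$; otherwise it is called directed. $\mathrm{Spec}$ is the multiset of eigenvalues of the adjacency matrix; a (di)graph is integral if all its eigenvalues are integers. Let $\omega$ be a generator of $\mathbb{F}_q^*$, $C_i^{(k,q)}=\omega^i\langle\omega^k\rangle$, $\zeta_p=e^{2\pi i/p}$ and $\mathrm{Tr}_{q/p}:\mathbb{F}_q\to\mathbb{F}_p$ the trace. The cyclotomic Gaussian periods are $\eta_i^{(k,q)}=\sum_{x\in C_i^{(k,q)}}\zeta_p^{\mathrm{Tr}_{q/p}(x)}$ for $0\le i\le k-1$. *)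

theory Defs
  imports
    "HOL-Analysis.Analysis"
    "HOL-Computational_Algebra.Computational_Algebra"
    "Graph_Theory.Graph_Theory"
begin

text \<open>
  The finite field with q elements is an arbitrary type of classes \<^class>\<open>field\<close> and
  \<^class>\<open>finite\<close> with \<open>CARD('a) = q\<close>.
\<close>

subsection \<open>Spectra of digraphs\<close>

text \<open>Only meaningful for digraphs without parallel arcs whose vertex set is the whole type.\<close>

definition adjacency_matrix :: "('a::finite, 'b) pre_digraph \<Rightarrow> complex ^ 'a ^ 'a" where
  "adjacency_matrix G = (\<chi> u v. if (u, v) \<in> arcs_ends G then 1 else 0)"

text \<open>The characteristic polynomial det (X I - A), a determinant over the polynomial ring.\<close>

definition charpoly :: "complex ^ 'n ^ 'n \<Rightarrow> complex poly" where
  "charpoly A = det (\<chi> i j. (if i = j then [:0, 1:] else 0) - [:A $ i $ j:])"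

text \<open>The multiset of eigenvalues, counted with algebraic multiplicity.\<close>

definition digraph_spectrum :: "('a::finite, 'b) pre_digraph \<Rightarrow> complex multiset" where
  "digraph_spectrum G = proots (charpoly (adjacency_matrix G))"

definition integral_digraph :: "('a::finite, 'b) pre_digraph \<Rightarrow> bool" where
  "integral_digraph G \<longleftrightarrow> set_mset (digraph_spectrum G) \<subseteq> \<int>"

subsection \<open>Generalized Paley graphs\<close>

definition cayley_digraph :: "'a::group_add set \<Rightarrow> 'a pair_pre_digraph" where
  "cayley_digraph S = \<lparr> pverts = UNIV, parcs = {(u, v). v - u \<in> S} \<rparr>"

definition power_residues :: "nat \<Rightarrow> 'a::field set" where
  "power_residues k = {x ^ k | x. x \<noteq> 0}"

text \<open>The field is determined by the vertex type, so only \<open>k\<close> remains as an argument.\<close>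

definition gen_paley :: "nat \<Rightarrow> 'a::field pair_pre_digraph" where
  "gen_paley k = cayley_digraph (power_residues k)"

subsection \<open>Gaussian periods\<close>

definition unit_group_generator :: "'a::field \<Rightarrow> bool" where
  "unit_group_generator \<omega> \<longleftrightarrow> range (\<lambda>j::int. \<omega> powi j) = UNIV - {0}"

definition cyclotomic_class :: "'a::field \<Rightarrow> nat \<Rightarrow> nat \<Rightarrow> 'a set" where
  "cyclotomic_class \<omega> k i = (\<lambda>y. \<omega> ^ i * y) ` range (\<lambda>j::int. (\<omega> ^ k) powi j)"

text \<open>
  The trace from the field with p^m elements to its prime field, as the sum of the
  conjugates of \<open>x\<close>; the value is still an element of the big field.
\<close>

definition field_trace :: "nat \<Rightarrow> nat \<Rightarrow> 'a::field \<Rightarrow> 'a" where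
  "field_trace p m x = (\<Sum>j<m. x ^ (p ^ j))"

text \<open>
  The representative in {0..<p} of an element of the prime field; unspecified for
  elements outside the prime field (the trace never takes such values).
\<close>

definition prime_field_rep :: "nat \<Rightarrow> 'a::field \<Rightarrow> nat" where
  "prime_field_rep p y = (THE n. n < p \<and> of_nat n = y)"

definition zeta :: "nat \<Rightarrow> complex" where
  "zeta p = exp (2 * of_real pi * \<i> / of_nat p)"

definition gaussian_period :: "nat \<Rightarrow> nat \<Rightarrow> 'a::field \<Rightarrow> nat \<Rightarrow> nat \<Rightarrow> complex" where
  "gaussian_period p m \<omega> k i =
     (\<Sum>x\<in>cyclotomic_class \<omega> k i. zeta p ^ prime_field_rep p (field_trace p m x))"

end

theory Submission
  imports "HOL-Number_Theory.Residues" Defs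
begin

text \<open>
  Let \<open>S\<close> be the set of \<open>k\<close>-th power residues and \<open>\<psi> x = zeta p ^ Tr x\<close>. The additive characters
  \<open>u \<mapsto> \<psi> (a * u)\<close> diagonalize every Cayley digraph on the field
  (\<open>set_spectrum_cayley_digraph\<close>), so the eigenvalues of the generalized Paley graph are the sums
  \<open>\<lambda> a = (\<Sum>s\<in>S. \<psi> (a * s))\<close>. They are the integer \<open>\<lambda> 0 = card S\<close> together with the Gaussian
  periods, because for \<open>a \<noteq> 0\<close> the value of \<open>\<lambda> a\<close> depends only on the coset of \<open>a\<close> modulo \<open>S\<close>
  (\<open>integral_char_sums_power_residues_iff\<close>). Both integrality conditions thus say that all
  \<open>\<lambda> a\<close> are integers, and this holds iff \<open>S\<close> contains the unit group of the prime field: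

  If all \<open>\<lambda> a\<close> are integers, then Galois conjugation gives \<open>\<lambda> (c * a) = \<lambda> a\<close> for every unit \<open>c\<close>
  of the prime field (\<open>char_sum_galois_invariant\<close>), and Fourier inversion shows that \<open>S\<close> is
  invariant under multiplication by \<open>c\<close>; as \<open>1 \<in> S\<close>, also \<open>c \<in> S\<close>. Galois invariance rests on the
  irreducibility of the \<open>p\<close>-th cyclotomic polynomial, obtained from Eisenstein's criterion in the
  form of \<open>zeta_integer_relation\<close>. Conversely, if \<open>S\<close> contains these units, then all nonzero
  traces occur equally often on \<open>a * S\<close>, and \<open>\<lambda> a\<close> is a difference of two cardinalities
  (\<open>integral_if_prime_subfield_subset\<close>).

  In the cyclic unit group, containment of the subgroup of order \<open>p - 1\<close> in the subgroup of index
  \<open>k\<close> means \<open>k dvd (q - 1) div (p - 1)\<close> (\<open>prime_subfield_subset_power_residues_iff\<close>). Finally,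
  \<open>-1\<close> lies in the prime field, so integrality puts it into \<open>S\<close>, which makes the graph symmetric.
\<close>

section \<open>Integer relations between powers of a root of unity\<close>

text \<open>
  Eisenstein's criterion, stated for factorizations rather than for irreducibility, so that
  no primitivity assumption is needed.
\<close>

lemma Eisenstein_factorization:
  fixes f g h :: "'a::idom poly" and p :: 'a
  assumes p: "prime_elem p" and f: "f = g * h"
    and lead: "\<not> p dvd lead_coeff f"
    and low: "\<And>i. i < degree f \<Longrightarrow> p dvd coeff f i"
    and const: "\<not> p ^ 2 dvd coeff f 0"
  shows "degree g = 0 \<or> degree h = 0"
proof (rule ccontr)
  assume "\<not> ?thesis"
  hence dg: "degree g > 0" and dh: "degree h > 0" by auto
  have "f \<noteq> 0" using lead by auto
  hence "degree f = degree g + degree h" using f by (auto intro: degree_mult_eq)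
  \<comment> \<open>If the constant term of a nonconstant factor \<open>v\<close> is prime to \<open>p\<close>, the lowest coefficient of
      the cofactor that is prime to \<open>p\<close> gives a coefficient of \<open>f\<close> below the leading one that is
      prime to \<open>p\<close>.\<close>
  have key: False if "f = u * v" "degree v > 0" "\<not> p dvd coeff v 0" for u v
  proof -
    have uv: "u \<noteq> 0" "v \<noteq> 0" using \<open>f \<noteq> 0\<close> that by auto
    have du: "degree u < degree f" using uv that by (simp add: degree_mult_eq)
    have "\<not> p dvd lead_coeff u" using lead that by (auto simp: lead_coeff_mult)
    then obtain i where i: "\<not> p dvd coeff u i" "\<And>j. j < i \<Longrightarrow> p dvd coeff u j"
      using exists_least_iff[of "\<lambda>i. \<not> p dvd coeff u i"] by auto
    have "i \<le> degree u" using i(1) by (metis coeff_eq_0 dvd_0_right linorder_not_less)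
    hence "p dvd coeff f i" using low du by auto
    moreover have "coeff f i = (\<Sum>j<i. coeff u j * coeff v (i - j)) + coeff u i * coeff v 0"
      unfolding that(1) coeff_mult by (simp add: lessThan_Suc_atMost[symmetric])
    moreover have "p dvd (\<Sum>j<i. coeff u j * coeff v (i - j))"
      by (intro dvd_sum dvd_mult2) (auto intro: i(2))
    ultimately have "p dvd coeff u i * coeff v 0"
      by (simp add: dvd_add_right_iff)
    thus False using p i(1) that(3) by (simp add: prime_elem_dvd_mult_iff)
  qed
  have "coeff f 0 = coeff g 0 * coeff h 0" using f by (simp add: coeff_mult)
  hence "\<not> (p dvd coeff g 0 \<and> p dvd coeff h 0)"
    using const by (auto simp: power2_eq_square mult_dvd_mono)
  thus False using key[of g h] key[of h g] f dg dh by (auto simp: mult.commute)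
qed

text \<open>
  Evaluation of an integer polynomial at a complex number.
\<close>

definition int_poly_eval :: "int poly \<Rightarrow> complex \<Rightarrow> complex" where
  "int_poly_eval f \<alpha> = poly (map_poly of_int f) \<alpha>"

lemma int_poly_eval_0 [simp]: "int_poly_eval 0 \<alpha> = 0"
  by (simp add: int_poly_eval_def)

lemma int_poly_eval_pCons [simp]: "int_poly_eval (pCons c f) \<alpha> = of_int c + \<alpha> * int_poly_eval f \<alpha>"
  by (simp add: int_poly_eval_def map_poly_pCons)

lemma int_poly_eval_add [simp]: "int_poly_eval (f + g) \<alpha> = int_poly_eval f \<alpha> + int_poly_eval g \<alpha>"
  by (induction f g rule: poly_induct2) (simp_all add: algebra_simps)

lemma int_poly_eval_smult [simp]: "int_poly_eval (smult c f) \<alpha> = of_int c * int_poly_eval f \<alpha>"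
  by (induction f) (simp_all add: algebra_simps)

lemma int_poly_eval_mult [simp]: "int_poly_eval (f * g) \<alpha> = int_poly_eval f \<alpha> * int_poly_eval g \<alpha>"
  by (induction f) (simp_all add: algebra_simps)

lemma int_poly_eval_pcompose: "int_poly_eval (pcompose f g) \<alpha> = int_poly_eval f (int_poly_eval g \<alpha>)"
  by (induction f) (simp_all add: pcompose_pCons)

lemma int_poly_eval_monom [simp]: "int_poly_eval (monom c n) \<alpha> = of_int c * \<alpha> ^ n"
  by (simp add: int_poly_eval_def map_poly_monom poly_monom)

lemma int_poly_eval_sum: "int_poly_eval (\<Sum>i\<in>A. f i) \<alpha> = (\<Sum>i\<in>A. int_poly_eval (f i) \<alpha>)"
  by (induction A rule: infinite_finite_induct) simp_all

text \<open>
  A weak form of the statement that an irreducible integer polynomial is a minimal polynomial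
  of its roots: a nonzero integer polynomial of least degree among those vanishing at
  \<open>\<alpha>\<close> may be taken primitive, pseudo-division makes it a divisor of a multiple of \<open>f\<close>,
  and Gauss' lemma makes it a divisor of \<open>f\<close> itself.
\<close>

lemma degree_ge_irreducible_root:
  fixes f g :: "int poly" and \<alpha> :: complex
  assumes irr: "\<And>u v. f = u * v \<Longrightarrow> degree u = 0 \<or> degree v = 0"
    and f: "int_poly_eval f \<alpha> = 0"
    and g: "g \<noteq> 0" "int_poly_eval g \<alpha> = 0"
  shows "degree f \<le> degree g"
proof -
  obtain h where h: "h \<noteq> 0" "int_poly_eval h \<alpha> = 0"
    and min: "\<And>u. u \<noteq> 0 \<Longrightarrow> int_poly_eval u \<alpha> = 0 \<Longrightarrow> degree h \<le> degree u"
    using ex_has_least_nat[of "\<lambda>u. u \<noteq> 0 \<and> int_poly_eval u \<alpha> = 0" g degree] g by blast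
  define P where "P = primitive_part h"
  have P: "P \<noteq> 0" "content P = 1" "degree P = degree h" using h by (auto simp: P_def)
  have "h = smult (content h) P" by (simp add: P_def)
  hence "of_int (content h) * int_poly_eval P \<alpha> = 0"
    using h(2) by (metis int_poly_eval_smult)
  hence P0: "int_poly_eval P \<alpha> = 0" using h(1) by simp
  define r where "r = pseudo_mod f P"
  obtain a q where aq: "a \<noteq> 0" "smult a f = P * q + r" and r: "r = 0 \<or> degree r < degree P"
    using pseudo_mod[OF P(1), of f] unfolding r_def by blast
  have "int_poly_eval ((smult a f)) \<alpha> = int_poly_eval ((P * q + r)) \<alpha>" using aq by simp
  hence "int_poly_eval r \<alpha> = 0" using f P0
    by simp
  hence "r = 0" using r min[of r] P(3) by linarith
  \<comment> \<open>Gauss' lemma: take primitive parts on both sides of \<open>smult a f = P * q\<close>.\<close>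
  hence "smult (unit_factor a) (primitive_part f) = P * primitive_part q"
    using aq by (metis P(2) add.right_neutral primitive_part_mult primitive_part_prim primitive_part_smult)
  hence "smult (unit_factor a * unit_factor a) (primitive_part f) 
       = P * smult (unit_factor a) (primitive_part q)"
    by (metis mult_smult_right smult_smult)
  moreover have "unit_factor a * unit_factor a = 1" using aq by (simp add: sgn_if)
  ultimately have "f = P * smult (content f * unit_factor a) (primitive_part q)"
    by (metis (no_types, lifting) content_times_primitive_part mult_smult_right smult_1_left smult_smult)
  then obtain s where s: "f = P * s" by blast
  show ?thesis
  proof (cases "degree P = 0")
    case True
    then obtain c where "P = [:c:]" using degree_eq_zeroE by blast
    thus ?thesis using P0 P(1) by simp
  next
    case False
    hence "degree s = 0" using irr[OF s] by simp
    hence "degree f \<le> degree P" using s by (metis add.right_neutral degree_mult_le)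
    thus ?thesis using P(3) min g by fastforce
  qed
qed

lemma zeta_primitive_root:
  assumes "p > 0"
  shows "zeta p ^ a = 1 \<longleftrightarrow> p dvd a"
proof -
  have "zeta p ^ a = exp (2 * of_real pi * \<i> * of_nat a / of_nat p)"
    unfolding zeta_def by (simp flip: exp_of_nat_mult add: algebra_simps)
  thus ?thesis using complex_root_unity_eq_1[of p a] assms by simp
qed

text \<open>
  The polynomial \<open>((X + 1)^p - 1) / X\<close>, whose coefficients are binomial coefficients, vanishes
  at \<open>zeta p - 1\<close> and satisfies Eisenstein's criterion at \<open>p\<close>.
\<close>

lemma degree_ge_root_zeta_minus_1:
  fixes h :: "int poly"
  assumes p: "prime p" and h: "h \<noteq> 0" "int_poly_eval h (zeta p - 1) = 0"
  shows "p - 1 \<le> degree h"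
proof -
  define f :: "int poly" where "f = (\<Sum>i<p. monom (int (p choose Suc i)) i)"
  have p1: "p > 1" using p prime_gt_1_nat by blast
  have cf: "coeff f i = (if i < p then int (p choose Suc i) else 0)" for i
    by (simp add: f_def coeff_sum)
  have "degree f = p - 1"
  proof (rule antisym)
    show "degree f \<le> p - 1" by (rule degree_le) (auto simp: cf)
    show "p - 1 \<le> degree f" by (rule le_degree) (use p1 in \<open>simp add: cf\<close>)
  qed
  have irr: "degree u = 0 \<or> degree v = 0" if "f = u * v" for u v
  proof (rule Eisenstein_factorization[OF _ that])
    show "prime_elem (int p)" using p by simp
    show "\<not> int p dvd lead_coeff f" using p1 \<open>degree f = p - 1\<close> by (simp add: cf)
    show "int p dvd coeff f i" if "i < degree f" for i
      using that \<open>degree f = p - 1\<close> p by (auto simp: cf intro!: dvd_choose_prime)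
    show "\<not> (int p)\<^sup>2 dvd coeff f 0" using p1 
      by (simp add: cf power2_eq_square flip: of_nat_mult)
  qed
  have z: "zeta p \<noteq> 1" "zeta p ^ p = 1" 
    using zeta_primitive_root[of p 1] zeta_primitive_root[of p p] p1 by auto
  define x where "x = zeta p - 1"
  have "x * int_poly_eval f x = (\<Sum>i<p. of_nat (p choose Suc i) * x ^ Suc i)"
    unfolding f_def by (simp add: int_poly_eval_sum sum_distrib_left mult_ac)
  also have "\<dots> = (\<Sum>i\<le>p. of_nat (p choose i) * x ^ i) - 1"
    using p1 by (simp add: lessThan_Suc_atMost[symmetric] sum.lessThan_Suc_shift del: sum.lessThan_Suc)
  also have "(\<Sum>i\<le>p. of_nat (p choose i) * x ^ i) = (x + 1) ^ p"
    by (subst binomial_ring) simp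
  also have "\<dots> = 1" using z by (simp add: x_def)
  finally have "int_poly_eval f x = 0" using z by (simp add: x_def)
  from degree_ge_irreducible_root[OF irr this h(1)] h(2)
  show ?thesis using \<open>degree f = p - 1\<close> by (simp add: x_def)
qed

text \<open>
  The only integer relations between the powers \<open>1, zeta p, ..., zeta p ^ (p - 1)\<close> are the
  multiples of \<open>1 + zeta p + ... + zeta p ^ (p - 1) = 0\<close>.
\<close>

lemma zeta_integer_relation:
  fixes c :: "nat \<Rightarrow> int"
  assumes p: "prime p" and rel: "(\<Sum>t<p. of_int (c t) * zeta p ^ t) = 0" and t: "t < p"
  shows "c t = c (p - 1)"
proof -
  \<comment> \<open>Subtracting the multiple \<open>c (p - 1)\<close> of the basic relation removes the top coefficient, which
      leaves a polynomial of degree less than \<open>p - 1\<close> vanishing at \<open>zeta p\<close>.\<close>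
  define f :: "int poly" where "f = (\<Sum>t<p. monom (c t - c (p - 1)) t)"
  have p1: "p > 1" using p prime_gt_1_nat by blast
  have cf: "coeff f i = (if i < p then c i - c (p - 1) else 0)" for i
    by (simp add: f_def coeff_sum)
  have z: "zeta p \<noteq> 1" "zeta p ^ p = 1" 
    using zeta_primitive_root[of p 1] zeta_primitive_root[of p p] p1 by auto
  have geo: "(\<Sum>t<p. zeta p ^ t) = 0" using z by (simp add: sum_gp_strict)
  have "int_poly_eval f (zeta p) = (\<Sum>t<p. (of_int (c t) - of_int (c (p-1))) * zeta p ^ t)"
    unfolding f_def by (simp add: int_poly_eval_sum)
  also have "\<dots> = 0" using rel geo by (simp add: left_diff_distrib sum_subtractf flip: sum_distrib_left)
  finally have f0: "int_poly_eval f (zeta p) = 0" .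
  define h where "h = pcompose f [:1, 1:]"
  have "int_poly_eval h (zeta p - 1) = 0"
    using f0 by (simp add: h_def int_poly_eval_pcompose)
  moreover have "degree h < p - 1"
  proof -
    have "degree h = degree f" by (simp add: h_def degree_pcompose)
    also have "degree f \<le> p - 2"
    proof (rule degree_le, intro allI impI)
      fix i assume "p - 2 < i"
      hence "i = p - 1 \<or> i \<ge> p" by linarith
      thus "coeff f i = 0" by (auto simp: cf)
    qed
    finally show ?thesis using p1 by linarith
  qed
  ultimately have "h = 0" using degree_ge_root_zeta_minus_1[OF p, of h] by linarith
  hence "f = 0" by (simp add: h_def pcompose_eq_0_iff)
  thus ?thesis using cf[of t] t by simp
qed

section \<open>Characters and spectra of Cayley digraphs over a finite field\<close>

lemma poly_charpoly:
  "poly (charpoly A) x = det (\<chi> i j. (if i = j then x else 0) - A $ i $ j)"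
  unfolding charpoly_def det_def
  by (simp add: poly_sum poly_prod if_distrib[of "\<lambda>p. poly p x"] cong: if_cong)

lemma poly_charpoly_eq_0_iff:
  "poly (charpoly A) x = 0 \<longleftrightarrow> (\<exists>v. v \<noteq> 0 \<and> A *v v = x *s v)"
proof -
  define B where "B = (\<chi> i j. (if i = j then x else 0) - A $ i $ j)"
  have B: "B *v v = x *s v - A *v v" for v
    by (simp add: B_def vec_eq_iff matrix_vector_mult_def left_diff_distrib sum_subtractf
        if_distrib[of "\<lambda>c. c * _"] cong: if_cong)
  have "poly (charpoly A) x = 0 \<longleftrightarrow> \<not> invertible B"
    by (simp add: poly_charpoly B_def invertible_det_nz)
  also have "\<dots> \<longleftrightarrow> (\<exists>v. v \<noteq> 0 \<and> B *v v = 0)"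
    by (auto simp: invertible_left_inverse matrix_left_invertible_ker)
  also have "\<dots> \<longleftrightarrow> (\<exists>v. v \<noteq> 0 \<and> A *v v = x *s v)"
    by (auto simp: B)
  finally show ?thesis .
qed

lemma adjacency_matrix_cayley_mult:
  fixes S :: "'a::{ab_group_add,finite} set"
  shows
  "(adjacency_matrix (with_proj (cayley_digraph S)) *v v) $ u = (\<Sum>s\<in>S. v $ (u + s))"
proof -
  have "(adjacency_matrix (with_proj (cayley_digraph S)) *v v) $ u
      = (\<Sum>w\<in>{w. w - u \<in> S}. v $ w)"
    by (simp add: adjacency_matrix_def cayley_digraph_def matrix_vector_mult_def
        if_distrib[of "\<lambda>c. c * _"] sum.If_cases cong: if_cong)
  also have "\<dots> = (\<Sum>s\<in>S. v $ (u + s))"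
    by (rule sum.reindex_bij_witness[of _ "\<lambda>s. u + s" "\<lambda>w. w - u"]) auto
  finally show ?thesis .
qed

text \<open>
  A nontrivial character of the additive group of a finite field. Its multiplicative twists
  \<open>x \<mapsto> \<psi> (a * x)\<close> exhaust the additive characters, which is why they suffice for Fourier
  inversion.
\<close>

locale nontrivial_character =
  fixes \<psi> :: "'a::{field,finite} \<Rightarrow> complex"
  assumes add: "\<psi> (x + y) = \<psi> x * \<psi> y"
    and zero [simp]: "\<psi> 0 = 1"
    and nontrivial: "\<exists>x. \<psi> x \<noteq> 1"
begin

lemma sum_UNIV: "(\<Sum>x\<in>UNIV. \<psi> x) = 0"
proof -
  obtain y where y: "\<psi> y \<noteq> 1" using nontrivial by blast
  have "(\<Sum>x\<in>UNIV. \<psi> x) = (\<Sum>x\<in>UNIV. \<psi> (y + x))"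
    by (rule sum.reindex_bij_witness[of _ "\<lambda>x. y + x" "\<lambda>x. x - y"]) auto
  also have "\<dots> = \<psi> y * (\<Sum>x\<in>UNIV. \<psi> x)"
    by (simp add: add sum_distrib_left)
  finally show ?thesis using y by simp
qed

lemma orthogonality: "(\<Sum>a\<in>UNIV. \<psi> (a * x)) = (if x = 0 then of_nat CARD('a) else 0)"
proof (cases "x = 0")
  case False
  have "(\<Sum>a\<in>UNIV. \<psi> (a * x)) = (\<Sum>a\<in>UNIV. \<psi> a)"
    by (rule sum.reindex_bij_witness[of _ "\<lambda>a. a / x" "\<lambda>a. a * x"]) (use False in auto)
  thus ?thesis using False sum_UNIV by simp
qed simp

lemma fourier_inversion:
  "(\<Sum>a\<in>UNIV. (\<Sum>u\<in>UNIV. v u * \<psi> (a * u)) * \<psi> (- (a * x))) = of_nat CARD('a) * v x"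
proof -
  have "(\<Sum>a\<in>UNIV. (\<Sum>u\<in>UNIV. v u * \<psi> (a * u)) * \<psi> (- (a * x)))
      = (\<Sum>a\<in>UNIV. \<Sum>u\<in>UNIV. v u * \<psi> (a * (u - x)))"
    by (simp add: sum_distrib_right mult.assoc right_diff_distrib flip: add)
  also have "\<dots> = (\<Sum>u\<in>UNIV. v u * (\<Sum>a\<in>UNIV. \<psi> (a * (u - x))))"
    by (subst sum.swap) (simp add: sum_distrib_left)
  also have "\<dots> = of_nat CARD('a) * v x"
    by (simp add: orthogonality if_distrib[of "\<lambda>c. _ * c"] cong: if_cong)
  finally show ?thesis .
qed

text \<open>
  The sum of the character \<open>x \<mapsto> \<psi> (a * x)\<close> over \<open>S\<close>, that is the Fourier transform of the
  indicator function of \<open>S\<close>.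
\<close>

definition char_sum :: "'a set \<Rightarrow> 'a \<Rightarrow> complex" where
  "char_sum S a = (\<Sum>s\<in>S. \<psi> (a * s))"

lemma char_sum_0: "char_sum S 0 = of_nat (card S)"
  by (simp add: char_sum_def)

lemma char_sum_inversion:
  "(\<Sum>a\<in>UNIV. char_sum S a * \<psi> (- (a * x))) = (if x \<in> S then of_nat CARD('a) else 0)"
proof -
  have "char_sum S a = (\<Sum>u\<in>UNIV. (if u \<in> S then 1 else 0) * \<psi> (a * u))" for a
    by (simp add: char_sum_def if_distrib[of "\<lambda>c. c * _"] sum.If_cases cong: if_cong)
  thus ?thesis using fourier_inversion[of "\<lambda>u. if u \<in> S then 1 else 0" x] by simp
qed

text \<open>
  The character \<open>u \<mapsto> \<psi> (a * u)\<close> is an eigenvector with eigenvalue \<open>char_sum S a\<close>. There are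
  no further eigenvalues, since the Fourier transform turns the adjacency matrix into
  multiplication by these numbers and is injective.
\<close>

lemma set_spectrum_cayley_digraph:
  "set_mset (digraph_spectrum (with_proj (cayley_digraph S))) = range (char_sum S)"
proof -
  define A where "A = adjacency_matrix (with_proj (cayley_digraph S))"
  have A: "(A *v v) $ u = (\<Sum>s\<in>S. v $ (u + s))" for v u
    unfolding A_def by (rule adjacency_matrix_cayley_mult)
  have root: "poly (charpoly A) x = 0 \<longleftrightarrow> x \<in> range (char_sum S)" for x
  proof
    assume "poly (charpoly A) x = 0"
    then obtain v where v: "v \<noteq> 0" "A *v v = x *s v"
      by (auto simp: poly_charpoly_eq_0_iff)
    define V where "V a = (\<Sum>u\<in>UNIV. v $ u * \<psi> (a * u))" for a
    have "x * V a = char_sum S (- a) * V a" for a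
    proof -
      have "x * V a = (\<Sum>u\<in>UNIV. (A *v v) $ u * \<psi> (a * u))"
        by (simp add: v(2) V_def sum_distrib_left mult.assoc)
      also have "\<dots> = (\<Sum>s\<in>S. \<Sum>u\<in>UNIV. v $ (u + s) * \<psi> (a * u))"
        by (simp add: A sum_distrib_right) (rule sum.swap)
      also have "\<dots> = (\<Sum>s\<in>S. \<Sum>u\<in>UNIV. v $ u * \<psi> (a * (u - s)))"
      proof (rule sum.cong[OF refl])
        fix s
        show "(\<Sum>u\<in>UNIV. v $ (u + s) * \<psi> (a * u)) = (\<Sum>u\<in>UNIV. v $ u * \<psi> (a * (u - s)))"
          by (rule sum.reindex_bij_witness[of _ "\<lambda>u. u - s" "\<lambda>u. u + s"]) auto
      qed
      also have "\<dots> = (\<Sum>s\<in>S. \<psi> (- a * s) * V a)"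
        by (simp add: V_def sum_distrib_left right_diff_distrib mult_ac add[of _ "- _", simplified])
      also have "\<dots> = char_sum S (- a) * V a"
        by (simp add: char_sum_def sum_distrib_right)
      finally show ?thesis .
    qed
    moreover have "\<exists>a. V a \<noteq> 0"
    proof (rule ccontr)
      assume "\<not> ?thesis"
      hence "v $ u = 0" for u
        using fourier_inversion[of "\<lambda>u. v $ u" u] by (simp add: V_def)
      thus False using v(1) by (simp add: vec_eq_iff)
    qed
    ultimately have "\<exists>a. x = char_sum S (- a)" by auto
    thus "x \<in> range (char_sum S)" by blast
  next
    assume "x \<in> range (char_sum S)"
    then obtain a where a: "x = char_sum S a" by blast
    define v where "v = (\<chi> u. \<psi> (a * u))"
    have "v $ 0 \<noteq> 0" by (simp add: v_def)
    hence "v \<noteq> 0" by (metis zero_index)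
    moreover have "A *v v = x *s v"
      by (simp add: vec_eq_iff A) (simp add: v_def a char_sum_def distrib_left add sum_distrib_left mult.commute)
    ultimately show "poly (charpoly A) x = 0" by (auto simp: poly_charpoly_eq_0_iff)
  qed
  \<comment> \<open>The multiset of roots of the zero polynomial is empty by convention, so nonvanishing matters.\<close>
  have "charpoly A \<noteq> 0"
  proof
    assume "charpoly A = 0"
    hence "(UNIV :: complex set) = range (char_sum S)" using root by auto
    thus False using infinite_UNIV_char_0[where ?'a = complex] by (metis finite finite_imageI)
  qed
  thus ?thesis using root by (auto simp: digraph_spectrum_def A_def[symmetric])
qed

lemma integral_cayley_digraph_iff:
  "integral_digraph (with_proj (cayley_digraph S)) \<longleftrightarrow> (\<forall>a. char_sum S a \<in> \<int>)"
  by (auto simp: integral_digraph_def set_spectrum_cayley_digraph)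

end

section \<open>The trace character and the prime subfield\<close>

lemma zeta_power_mod: "p > 0 \<Longrightarrow> zeta p ^ (n mod p) = zeta p ^ n"
proof -
  assume "p > 0"
  hence "zeta p ^ p = 1" using zeta_primitive_root[of p p] by simp
  hence "zeta p ^ (p * (n div p) + n mod p) = zeta p ^ (n mod p)"
    by (simp only: power_add power_mult) simp
  thus ?thesis by simp
qed

lemma sum_zeta_power_multiple:
  assumes "p > 0" "\<not> p dvd c"
  shows "(\<Sum>t<p. zeta p ^ (c * t)) = 0"
proof -
  have "zeta p ^ c \<noteq> 1" using zeta_primitive_root assms by simp
  moreover have "(zeta p ^ c) ^ p = 1" using zeta_primitive_root[of p "c * p"] assms
    by (simp add: power_mult)
  ultimately show ?thesis by (simp add: power_mult sum_gp_strict)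
qed

text \<open>
  Multiplication by \<open>x\<close> permutes the units, so it does not change their product.
\<close>

lemma power_card_UNIV_minus_1:
  fixes x :: "'a::{field,finite}"
  assumes "x \<noteq> 0"
  shows "x ^ (CARD('a) - 1) = 1"
proof -
  define P where "P = (\<Prod>y\<in>UNIV - {0::'a}. y)"
  have "P = (\<Prod>y\<in>UNIV - {0}. x * y)"
    unfolding P_def
    by (rule prod.reindex_bij_witness[of _ "\<lambda>y. x * y" "\<lambda>y. y / x"]) (use assms in auto)
  also have "\<dots> = x ^ (CARD('a) - 1) * P"
    by (simp add: prod.distrib P_def card_Diff_singleton)
  finally show ?thesis by (simp add: P_def)
qed

text \<open>
  The canonical additive character \<open>x \<mapsto> zeta p ^ Tr x\<close>. The Gaussian periods are its sums over
  cyclotomic classes.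
\<close>

definition trace_character :: "nat \<Rightarrow> nat \<Rightarrow> 'a::field \<Rightarrow> complex" where
  "trace_character p m x = zeta p ^ prime_field_rep p (field_trace p m x)"

text \<open>
  The prime subfield, given as the fixed points of the Frobenius map (this is the prime subfield
  in characteristic \<open>p\<close>, see \<open>bij_betw_prime_subfield\<close>).
\<close>

definition prime_subfield :: "nat \<Rightarrow> 'a::field set" where
  "prime_subfield p = {c. c ^ p = c}"

context
  fixes p m :: nat
  assumes p: "prime p" and card: "CARD('a::{field,finite}) = p ^ m"
begin

lemma p_gt_1: "p > 1"
  using p prime_gt_1_nat by blast

lemma m_pos: "m > 0"
proof (rule ccontr)
  assume "\<not> m > 0"
  hence "CARD('a) = 1" using card by simp
  then obtain x :: 'a where "UNIV = {x}" by (auto simp: card_1_singleton_iff)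
  thus False by (metis UNIV_I singletonD zero_neq_one)
qed

lemma CHAR_eq_p: "CHAR('a) = p"
proof -
  have "prime CHAR('a)"
    using prime_CHAR_semidom[where ?'a = 'a] finite_imp_CHAR_pos[where ?'a = 'a] by simp
  moreover have "CHAR('a) dvd p ^ m" using CHAR_dvd_CARD[where ?'a = 'a] card by simp
  ultimately show ?thesis using p by (metis prime_dvd_power_nat primes_dvd_imp_eq)
qed

lemma power_card_eq_self: "(x :: 'a) ^ (p ^ m) = x"
proof (cases "x = 0")
  case True
  thus ?thesis using p_gt_1 by (simp add: power_0_left)
next
  case False
  have "p ^ m = Suc (p ^ m - 1)" using p_gt_1 by simp
  thus ?thesis using power_card_UNIV_minus_1[OF False] card by (metis mult_1_right power_Suc)
qed

lemma frobenius_add: "((x :: 'a) + y) ^ (p ^ j) = x ^ (p ^ j) + y ^ (p ^ j)"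
  by (rule freshmans_dream') (simp_all add: CHAR_eq_p p)

lemma of_nat_eq_iff_mod: "(of_nat a :: 'a) = of_nat b \<longleftrightarrow> a mod p = b mod p"
  by (simp add: of_nat_eq_iff_cong_CHAR CHAR_eq_p unique_euclidean_semiring_class.cong_def)

lemma bij_betw_prime_subfield: "bij_betw of_nat {..<p} (prime_subfield p :: 'a set)"
proof -
  have inj: "inj_on (of_nat :: nat \<Rightarrow> 'a) {..<p}"
    by (auto simp: inj_on_def of_nat_eq_iff_mod)
  have fermat: "(of_nat n :: 'a) ^ p = of_nat n" for n
  proof (induction n)
    case (Suc n)
    thus ?case using frobenius_add[of 1 "of_nat n" 1] by simp
  qed (use p_gt_1 in \<open>simp add: power_0_left\<close>)
  define P :: "'a poly" where "P = monom 1 p - monom 1 1"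
  have "coeff P p = 1" using p_gt_1 by (simp add: P_def)
  hence "P \<noteq> 0" by auto
  hence "card {x. poly P x = 0} \<le> degree P" by (rule card_poly_roots_bound)
  also have "degree P \<le> p" unfolding P_def
    by (rule degree_diff_le) (use p_gt_1 in \<open>auto simp: degree_monom_eq\<close>)
  also have "{x. poly P x = 0} = prime_subfield p"
    by (auto simp: P_def poly_monom prime_subfield_def)
  finally have "card (prime_subfield p :: 'a set) \<le> card (of_nat ` {..<p} :: 'a set)"
    using inj by (simp add: card_image)
  moreover have "of_nat ` {..<p} \<subseteq> (prime_subfield p :: 'a set)"
    using fermat by (auto simp: prime_subfield_def)
  ultimately have "of_nat ` {..<p} = (prime_subfield p :: 'a set)"
    by (intro card_seteq) auto
  thus ?thesis using inj by (simp add: bij_betw_def)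
qed

lemma prime_field_rep_of_nat: "prime_field_rep p (of_nat n :: 'a) = n mod p"
  unfolding prime_field_rep_def of_nat_eq_iff_mod
  by (rule the_equality) (use p_gt_1 in auto)

lemma field_trace_mem: "field_trace p m (x :: 'a) \<in> prime_subfield p"
proof -
  have "field_trace p m x ^ p = (\<Sum>j<m. x ^ (p ^ Suc j))"
    unfolding field_trace_def
    by (subst freshmans_dream_sum) (simp_all add: CHAR_eq_p p mult.commute flip: power_mult)
  also have "\<dots> = (\<Sum>j<m. x ^ (p ^ j)) + x ^ (p ^ m) - x ^ (p ^ 0)"
    using sum.lessThan_Suc_shift[of "\<lambda>j. x ^ (p ^ j)" m] sum.lessThan_Suc[of "\<lambda>j. x ^ (p ^ j)" m]
    by (metis add_diff_cancel_left')
  also have "\<dots> = field_trace p m x" by (simp add: field_trace_def power_card_eq_self)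
  finally show ?thesis by (simp add: prime_subfield_def)
qed

lemma field_trace_eq_of_nat: "\<exists>n<p. field_trace p m (x :: 'a) = of_nat n"
  using field_trace_mem[of x] bij_betw_prime_subfield by (auto simp: bij_betw_def)

lemma field_trace_add: "field_trace p m ((x :: 'a) + y) = field_trace p m x + field_trace p m y"
  by (simp add: field_trace_def frobenius_add sum.distrib)

lemma field_trace_mult:
  assumes "c \<in> prime_subfield p"
  shows "field_trace p m (c * (x :: 'a)) = c * field_trace p m x"
proof -
  have "c ^ (p ^ j) = c" for j
    by (induction j) (use assms in \<open>simp_all add: prime_subfield_def power_mult\<close>)
  thus ?thesis by (simp add: field_trace_def power_mult_distrib sum_distrib_left)
qed

lemma field_trace_nonzero: "\<exists>x :: 'a. field_trace p m x \<noteq> 0"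
proof (rule ccontr)
  assume "\<not> ?thesis"
  hence *: "field_trace p m (x :: 'a) = 0" for x by simp
  define P :: "'a poly" where "P = (\<Sum>j<m. monom 1 (p ^ j))"
  have "coeff P 1 = (\<Sum>j<m. if j = 0 then 1 else 0)"
    unfolding P_def coeff_sum by (intro sum.cong) (use p_gt_1 in auto)
  also have "\<dots> = 1" using m_pos by simp
  finally have "P \<noteq> 0" by auto
  hence "card {x. poly P x = 0} \<le> degree P" by (rule card_poly_roots_bound)
  also have "{x. poly P x = 0} = UNIV"
    using * by (auto simp: P_def poly_sum poly_monom field_trace_def)
  also have "degree P \<le> p ^ (m - 1)"
    unfolding P_def
  proof (rule degree_sum_le)
    fix j assume "j \<in> {..<m}"
    hence "p ^ j \<le> p ^ (m - 1)" using p_gt_1 by (intro power_increasing) auto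
    thus "degree (monom (1 :: 'a) (p ^ j)) \<le> p ^ (m - 1)"
      by (simp add: degree_monom_eq)
  qed simp
  also have "p ^ (m - 1) < p ^ m" using p_gt_1 m_pos by simp
  finally show False using card by simp
qed

lemma trace_character_eq:
  "field_trace p m (x :: 'a) = of_nat n \<Longrightarrow> trace_character p m x = zeta p ^ n"
  using p_gt_1 by (simp add: trace_character_def prime_field_rep_of_nat zeta_power_mod)

lemma nontrivial_trace_character: "nontrivial_character (trace_character p m :: 'a \<Rightarrow> complex)"
proof
  fix x y :: 'a
  obtain a b where "field_trace p m x = of_nat a" "field_trace p m y = of_nat b"
    using field_trace_eq_of_nat by blast
  thus "trace_character p m (x + y) = trace_character p m x * trace_character p m y"
    using trace_character_eq[of x a] trace_character_eq[of y b] trace_character_eq[of "x + y" "a + b"]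
    by (simp add: field_trace_add power_add)
next
  show "trace_character p m (0 :: 'a) = 1"
    using trace_character_eq[of 0 0] p_gt_1 by (simp add: field_trace_def power_0_left)
next
  obtain x :: 'a where x: "field_trace p m x \<noteq> 0" using field_trace_nonzero by blast
  obtain n where n: "n < p" "field_trace p m x = of_nat n" using field_trace_eq_of_nat by blast
  hence "\<not> p dvd n" using x by (metis dvd_imp_le gr0I nat_dvd_not_less of_nat_0)
  hence "trace_character p m x \<noteq> 1" 
    using trace_character_eq[OF n(2)] zeta_primitive_root p_gt_1 by simp
  thus "\<exists>x :: 'a. trace_character p m x \<noteq> 1" by blast
qed

interpretation trace_char: nontrivial_character "trace_character p m :: 'a \<Rightarrow> complex"
  by (rule nontrivial_trace_character)

text \<open>
  Replacing \<open>a\<close> by \<open>c * a\<close> for a unit \<open>c\<close> of the prime field amounts to the Galois conjugation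
  \<open>zeta p \<mapsto> zeta p ^ c\<close>, which fixes integers. Here it is carried out on the coefficients:
  writing the sum as \<open>\<Sum>t<p. N t * zeta p ^ t\<close>, where \<open>N t\<close> counts the elements with trace \<open>t\<close>,
  an integer value forces \<open>N 1 = ... = N (p - 1)\<close>.
\<close>

lemma char_sum_galois_invariant:
  assumes int: "trace_char.char_sum S a \<in> \<int>" and c: "c \<in> prime_subfield p - {0}"
  shows "trace_char.char_sum S (c * a) = trace_char.char_sum S a"
proof -
  obtain z :: int where z: "trace_char.char_sum S a = of_int z" using int by (auto elim: Ints_cases)
  define r where "r s = prime_field_rep p (field_trace p m (a * s))" for s
  have r: "r s < p" "field_trace p m (a * s) = of_nat (r s)" for s
    using field_trace_eq_of_nat[of "a * s"] by (auto simp: r_def prime_field_rep_of_nat)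
  define N where "N t = card {s\<in>S. r s = t}" for t
  have group: "(\<Sum>s\<in>S. g (r s)) = (\<Sum>t<p. of_nat (N t) * g t)" for g :: "nat \<Rightarrow> complex"
  proof -
    have "(\<Sum>s\<in>S. g (r s)) = (\<Sum>t<p. \<Sum>s\<in>{s\<in>S. r s = t}. g (r s))"
      by (rule sum.group[symmetric]) (use r(1) in auto)
    thus ?thesis by (simp add: N_def)
  qed
  obtain n where n: "n < p" "c = of_nat n"
    using c bij_betw_prime_subfield by (auto simp: bij_betw_def)
  hence n_ndvd: "\<not> p dvd n" using c by (metis DiffD2 dvd_imp_le gr0I insertI1 nat_dvd_not_less of_nat_0)
  have sum_a: "trace_char.char_sum S a = (\<Sum>t<p. of_nat (N t) * zeta p ^ t)"
    unfolding trace_char.char_sum_def by (subst group[symmetric]) (simp add: trace_character_def r_def)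
  have "field_trace p m (c * a * s) = of_nat (n * r s)" for s
    using field_trace_mult[of c "a * s"] c n(2) r(2)[of s] by (simp add: mult.assoc)
  hence "trace_character p m (c * a * s) = zeta p ^ (n * r s)" for s
    by (rule trace_character_eq)
  hence sum_ca: "trace_char.char_sum S (c * a) = (\<Sum>t<p. of_nat (N t) * zeta p ^ (n * t))"
    unfolding trace_char.char_sum_def by (subst group[symmetric]) simp
  define b where "b t = int (N t) - (if t = 0 then z else 0)" for t
  have split: "(\<Sum>t<p. of_nat (N t) * g t) = (\<Sum>t<p. of_int (b t) * g t) + of_int z * g 0"
    for g :: "nat \<Rightarrow> complex"
  proof -
    have "(\<Sum>t<p. of_nat (N t) * g t) = (\<Sum>t<p. of_int (b t) * g t + (if t = 0 then of_int z * g 0 else 0))"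
      by (intro sum.cong) (auto simp: b_def algebra_simps)
    thus ?thesis using p_gt_1 by (simp add: sum.distrib)
  qed
  have "(\<Sum>t<p. of_int (b t) * zeta p ^ t) = 0"
    using sum_a z split[of "\<lambda>t. zeta p ^ t"] by simp
  hence b_const: "b t = b (p - 1)" if "t < p" for t
    using zeta_integer_relation[OF p _ that] by blast
  have "(\<Sum>t<p. of_int (b t) * zeta p ^ (n * t)) = (\<Sum>t<p. of_int (b (p - 1)) * zeta p ^ (n * t))"
  proof (rule sum.cong[OF refl])
    fix t assume "t \<in> {..<p}"
    thus "of_int (b t) * zeta p ^ (n * t) = of_int (b (p - 1)) * zeta p ^ (n * t)"
      using b_const[of t] by simp
  qed
  also have "\<dots> = of_int (b (p - 1)) * (\<Sum>t<p. zeta p ^ (n * t))"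
    by (simp add: sum_distrib_left)
  also have "\<dots> = 0" using sum_zeta_power_multiple[OF _ n_ndvd] p_gt_1 by simp
  finally have "trace_char.char_sum S (c * a) = of_int z"
    using sum_ca split[of "\<lambda>t. zeta p ^ (n * t)"] by simp
  thus ?thesis using z by simp
qed

text \<open>
  The Fourier transform of the indicator function of \<open>S\<close> is invariant under multiplication by
  units \<open>c\<close> of the prime field, hence so is \<open>S\<close>; in particular it contains \<open>c = c * 1\<close>.
\<close>

lemma prime_subfield_subset_if_integral:
  assumes int: "\<And>a. trace_char.char_sum S a \<in> \<int>" and "1 \<in> S"
  shows "prime_subfield p - {0} \<subseteq> (S :: 'a set)"
proof
  fix c :: 'a assume c: "c \<in> prime_subfield p - {0}"
  have "(\<Sum>a\<in>UNIV. trace_char.char_sum S a * trace_character p m (- (a * c)))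
      = (\<Sum>a\<in>UNIV. trace_char.char_sum S (c * a) * trace_character p m (- (a * c)))"
    using char_sum_galois_invariant[OF int c] by simp
  also have "\<dots> = (\<Sum>a\<in>UNIV. trace_char.char_sum S a * trace_character p m (- (a * 1)))"
    by (rule sum.reindex_bij_witness[of _ "\<lambda>a. a / c" "\<lambda>a. c * a"]) (use c in \<open>auto simp: mult.commute\<close>)
  finally show "c \<in> S"
    unfolding trace_char.char_sum_inversion using \<open>1 \<in> S\<close> by (auto split: if_splits)
qed

text \<open>
  Multiplication by \<open>y\<close> matches the elements \<open>s\<close> with \<open>Tr (a * s) = 1\<close> and those with
  \<open>Tr (a * s) = y\<close>, for every unit \<open>y\<close> of the prime field. So the sum is \<open>N 0 + N 1 * (-1)\<close>,
  where \<open>N y\<close> counts the elements with trace \<open>y\<close>.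
\<close>

lemma integral_if_prime_subfield_subset:
  assumes sub: "prime_subfield p - {0} \<subseteq> (S :: 'a set)"
    and mult: "\<And>x y. x \<in> S \<Longrightarrow> y \<in> S \<Longrightarrow> x * y \<in> S"
  shows "trace_char.char_sum S a \<in> \<int>"
proof -
  define K where "K = (prime_subfield p :: 'a set)"
  define T where "T y = {s\<in>S. field_trace p m (a * s) = y}" for y
  define g where "g y = zeta p ^ prime_field_rep p y" for y :: 'a
  have "0 \<in> K" using p_gt_1 by (simp add: K_def prime_subfield_def power_0_left)
  have card_T: "card (T y) = card (T 1)" if y: "y \<in> K - {0}" for y
  proof (rule bij_betw_same_card[OF bij_betw_byWitness[where f' = "\<lambda>s. y * s"]])
    have inv: "inverse y \<in> prime_subfield p - {0}"
      using y by (auto simp: K_def prime_subfield_def power_inverse)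
    show "(\<lambda>s. inverse y * s) ` T y \<subseteq> T 1"
      using y inv sub mult field_trace_mult[of "inverse y"]
      by (auto simp: T_def mult.left_commute[of a])
    show "(\<lambda>s. y * s) ` T 1 \<subseteq> T y"
      using y sub mult field_trace_mult[of y] by (auto simp: T_def K_def mult.left_commute[of a])
  qed (use y in auto)
  have "trace_char.char_sum S a = (\<Sum>y\<in>K. \<Sum>s\<in>T y. g (field_trace p m (a * s)))"
    unfolding trace_char.char_sum_def T_def trace_character_def g_def[symmetric]
    by (rule sum.group[symmetric]) (use field_trace_mem in \<open>auto simp: K_def\<close>)
  also have "\<dots> = (\<Sum>y\<in>K. of_nat (card (T y)) * g y)"
    by (simp add: T_def)
  also have "\<dots> = of_nat (card (T 0)) * g 0 + of_nat (card (T 1)) * (\<Sum>y\<in>K - {0}. g y)"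
    using \<open>0 \<in> K\<close> by (simp add: sum.remove[of K 0] card_T sum_distrib_left)
  also have "(\<Sum>y\<in>K - {0}. g y) = (\<Sum>y\<in>K. g y) - g 0"
    using \<open>0 \<in> K\<close> by (simp add: sum_diff1)
  also have "(\<Sum>y\<in>K. g y) = (\<Sum>t<p. zeta p ^ (1 * t))"
    unfolding K_def g_def
    by (subst sum.reindex_bij_betw[OF bij_betw_prime_subfield, symmetric]) (simp add: prime_field_rep_of_nat)
  also have "\<dots> = 0" using sum_zeta_power_multiple[of p 1] p_gt_1 by simp
  also have "g 0 = 1" using prime_field_rep_of_nat[of 0] by (simp add: g_def)
  finally show ?thesis by simp
qed

lemma minus_one_mem_prime_subfield: "(-1 :: 'a) \<in> prime_subfield p"
  using frobenius_add[of 1 "-1" 1] p_gt_1 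
  by (simp add: prime_subfield_def power_0_left add_eq_0_iff)

end

section \<open>Cyclotomic classes and power residues\<close>

lemma unit_group_generator_nonzero:
  assumes "unit_group_generator \<omega>"
  shows "\<omega> \<noteq> 0"
proof -
  have "\<omega> = \<omega> powi 1" by simp
  hence "\<omega> \<in> UNIV - {0}" using assms unfolding unit_group_generator_def by blast
  thus ?thesis by simp
qed

lemma one_mem_power_residues: "1 \<in> power_residues k"
  unfolding power_residues_def by (auto intro!: exI[of _ 1])

lemma power_residues_mult: "x \<in> power_residues k \<Longrightarrow> y \<in> power_residues k \<Longrightarrow> x * y \<in> power_residues k"
  by (auto simp: power_residues_def) (metis mult_eq_0_iff power_mult_distrib)

lemma cyclotomic_class_eq:
  assumes "unit_group_generator \<omega>"
  shows "cyclotomic_class \<omega> k i = (\<lambda>y. \<omega> ^ i * y) ` power_residues k"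
proof -
  have "(\<omega> ^ k) powi j = (\<omega> powi j) ^ k" for j :: int
    by (simp add: power_int_power power_int_power' mult.commute)
  hence "range (\<lambda>j::int. (\<omega> ^ k) powi j) = (\<lambda>x. x ^ k) ` range (\<lambda>j::int. \<omega> powi j)"
    by (simp add: image_image)
  also have "\<dots> = power_residues k"
    using assms by (auto simp: unit_group_generator_def power_residues_def)
  finally show ?thesis by (simp add: cyclotomic_class_def)
qed

lemma unit_group_generatorE:
  fixes \<omega> x :: "'a::{field,finite}"
  assumes \<omega>: "unit_group_generator \<omega>" and "x \<noteq> 0"
  obtains j where "x = \<omega> ^ j" "j < CARD('a) - 1"
proof -
  have nz: "\<omega> \<noteq> 0" using \<omega> by (rule unit_group_generator_nonzero)
  define e where "e = int (CARD('a) - 1)"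
  have "CARD('a) > 1" using card_mono[of UNIV "{0, x}"] \<open>x \<noteq> 0\<close> by simp
  hence "e > 0" by (simp add: e_def)
  obtain j where j: "x = \<omega> powi j" using \<omega> \<open>x \<noteq> 0\<close> unfolding unit_group_generator_def by blast
  also have "j = e * (j div e) + j mod e" by simp
  also have "\<omega> powi \<dots> = (\<omega> powi e) powi (j div e) * \<omega> powi (j mod e)"
    by (subst power_int_add) (use nz in \<open>auto simp: power_int_mult\<close>)
  also have "\<omega> powi e = 1"
    unfolding e_def power_int_of_nat by (rule power_card_UNIV_minus_1[OF nz])
  also have "1 powi (j div e) * \<omega> powi (j mod e) = \<omega> powi (j mod e)" by simp
  also have "\<dots> = \<omega> ^ nat (j mod e)" using \<open>e > 0\<close> by (simp add: power_int_def)
  finally show ?thesis using that[of "nat (j mod e)"] \<open>e > 0\<close> 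
    by (simp add: e_def nat_less_iff)
qed

lemma unit_group_generator_power_eq_1_iff:
  fixes \<omega> :: "'a::{field,finite}"
  assumes \<omega>: "unit_group_generator \<omega>"
  shows "\<omega> ^ j = 1 \<longleftrightarrow> CARD('a) - 1 dvd j"
proof -
  define e where "e = CARD('a) - 1"
  have "CARD('a) > 1" using card_mono[of UNIV "{0, 1 :: 'a}"] by simp
  hence "e > 0" by (simp add: e_def)
  have nz: "\<omega> ^ i \<noteq> 0" for i :: nat using unit_group_generator_nonzero[OF \<omega>] by simp
  have e: "\<omega> ^ e = 1" using power_card_UNIV_minus_1[of \<omega>] nz[of 1] by (simp add: e_def)
  have "(\<lambda>i. \<omega> ^ i) ` {..<e} = UNIV - {0}"
  proof
    show "UNIV - {0} \<subseteq> (\<lambda>i. \<omega> ^ i) ` {..<e}"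
    proof
      fix x :: 'a assume "x \<in> UNIV - {0}"
      then obtain j where "x = \<omega> ^ j" "j < e"
        using unit_group_generatorE[OF \<omega>, of x] unfolding e_def by auto
      thus "x \<in> (\<lambda>i. \<omega> ^ i) ` {..<e}" by simp
    qed
  qed (use unit_group_generator_nonzero[OF \<omega>] in auto)
  hence "card ((\<lambda>i. \<omega> ^ i) ` {..<e}) = card {..<e}" by (simp add: e_def card_Diff_singleton)
  hence inj: "inj_on (\<lambda>i. \<omega> ^ i) {..<e}" by (intro eq_card_imp_inj_on) auto
  show ?thesis unfolding e_def[symmetric]
  proof
    assume "\<omega> ^ j = 1"
    moreover have "\<omega> ^ j = \<omega> ^ (e * (j div e) + j mod e)" by simp
    ultimately have "\<omega> ^ (j mod e) = \<omega> ^ 0"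
      using e by (simp only: power_add power_mult) simp
    hence "j mod e = 0" using \<open>e > 0\<close> by (intro inj_onD[OF inj]) auto
    thus "e dvd j" by auto
  next
    assume "e dvd j"
    thus "\<omega> ^ j = 1" using e by (auto simp: power_mult)
  qed
qed

text \<open>
  The units of the prime field are the \<open>(p - 1)\<close>-st roots of unity, which are the powers of
  \<open>\<omega> ^ d\<close> with \<open>d = (q - 1) / (p - 1)\<close>, while the residues are the powers of \<open>\<omega> ^ k\<close>.
\<close>

lemma prime_subfield_subset_power_residues_iff:
  fixes \<omega> :: "'a::{field,finite}"
  assumes p: "prime p" and card: "CARD('a) = p ^ m" and k: "k > 0" "k dvd p ^ m - 1"
    and \<omega>: "unit_group_generator \<omega>"
  shows "prime_subfield p - {0} \<subseteq> (power_residues k :: 'a set) \<longleftrightarrow> k dvd (p ^ m - 1) div (p - 1)"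
proof -
  have p1: "p > 1" using p prime_gt_1_nat by blast
  define d where "d = (p ^ m - 1) div (p - 1)"
  have "int p - 1 dvd int p ^ m - 1" by (simp add: power_diff_1_eq)
  hence "int (p - 1) dvd int (p ^ m - 1)" using p1 by (simp add: of_nat_diff)
  hence "p - 1 dvd p ^ m - 1" by (simp only: int_dvd_int_iff)
  hence d: "p ^ m - 1 = d * (p - 1)" by (simp add: d_def)
  have one_iff: "\<omega> ^ j = 1 \<longleftrightarrow> d * (p - 1) dvd j" for j
    using unit_group_generator_power_eq_1_iff[OF \<omega>] card d by simp
  have subfield: "c \<in> prime_subfield p - {0} \<longleftrightarrow> c ^ (p - 1) = 1" for c :: 'a
  proof -
    have "c ^ p = c * c ^ (p - 1)" using p1 by (metis Suc_diff_1 less_trans power_Suc zero_less_one)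
    moreover have "(0 :: 'a) ^ (p - 1) \<noteq> 1" using p1 by (simp add: power_0_left)
    ultimately show ?thesis by (cases "c = 0") (auto simp: prime_subfield_def)
  qed
  show ?thesis unfolding d_def[symmetric]
  proof
    assume sub: "prime_subfield p - {0} \<subseteq> (power_residues k :: 'a set)"
    have "(\<omega> ^ d) ^ (p - 1) = 1" by (simp add: one_iff flip: power_mult)
    hence "\<omega> ^ d \<in> power_residues k" using sub subfield by blast
    then obtain x where x: "\<omega> ^ d = x ^ k" "x \<noteq> 0" by (auto simp: power_residues_def)
    obtain n where n: "p ^ m - 1 = k * n" using k(2) by blast
    have "\<omega> ^ (d * n) = x ^ (k * n)" by (simp add: power_mult x(1))
    also have "\<dots> = 1" using power_card_UNIV_minus_1[OF x(2)] card n by simp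
    finally have "d * (p - 1) dvd d * n" by (simp only: one_iff)
    hence "k * n dvd d * n" by (metis d n)
    moreover have "n > 0" using n p1 card card_mono[of UNIV "{0, 1 :: 'a}"] by (cases "n = 0") auto
    ultimately show "k dvd d" by simp
  next
    assume kd: "k dvd d"
    show "prime_subfield p - {0} \<subseteq> (power_residues k :: 'a set)"
    proof
      fix c :: 'a assume c: "c \<in> prime_subfield p - {0}"
      then obtain j where j: "c = \<omega> ^ j" using unit_group_generatorE[OF \<omega>] by blast
      have "\<omega> ^ (j * (p - 1)) = 1"
        using c unfolding subfield by (simp only: j power_mult)
      hence "d dvd j" using one_iff p1 by simp
      then obtain l where "j = k * l" using kd by (meson dvdE dvd_trans)
      hence "c = (\<omega> ^ l) ^ k" "\<omega> ^ l \<noteq> 0"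
        using c j k(1) by (auto simp: mult.commute power_0_left simp flip: power_mult)
      thus "c \<in> power_residues k" by (auto simp: power_residues_def)
    qed
  qed
qed

lemma (in nontrivial_character) char_sum_power_residues_mult:
  assumes "y \<noteq> 0"
  shows "char_sum (power_residues k) (a * y ^ k) = char_sum (power_residues k) a"
  unfolding char_sum_def
proof (rule sum.reindex_bij_witness[of _ "\<lambda>s. s / y ^ k" "\<lambda>s. y ^ k * s"])
  fix s :: 'a assume s: "s \<in> power_residues k"
  show "y ^ k * s \<in> power_residues k"
    using s assms by (intro power_residues_mult) (auto simp: power_residues_def)
  have "inverse y ^ k \<in> power_residues k" using assms by (auto simp: power_residues_def)
  from power_residues_mult[OF s this] show "s / y ^ k \<in> power_residues k"
    by (simp add: power_inverse divide_inverse)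
qed (use assms in \<open>auto simp: mult.assoc\<close>)

text \<open>
  The sum at \<open>a = \<omega> ^ j\<close> is the period of index \<open>j mod k\<close>, and the sum at \<open>0\<close> is the number
  of residues.
\<close>

lemma (in nontrivial_character) integral_char_sums_power_residues_iff:
  assumes k: "k > 0" and \<omega>: "unit_group_generator \<omega>"
  shows "(\<forall>a. char_sum (power_residues k) a \<in> \<int>)
    \<longleftrightarrow> (\<forall>i<k. (\<Sum>x\<in>cyclotomic_class \<omega> k i. \<psi> x) \<in> \<int>)"
proof -
  have nz: "\<omega> \<noteq> 0" using \<omega> by (rule unit_group_generator_nonzero)
  have period: "(\<Sum>x\<in>cyclotomic_class \<omega> k i. \<psi> x) = char_sum (power_residues k) (\<omega> ^ i)" for i
    unfolding cyclotomic_class_eq[OF \<omega>] char_sum_def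
    by (subst sum.reindex) (use nz in \<open>auto simp: inj_on_def\<close>)
  have "char_sum (power_residues k) a \<in> \<int>"
    if "\<forall>i<k. char_sum (power_residues k) (\<omega> ^ i) \<in> \<int>" for a
  proof (cases "a = 0")
    case True
    thus ?thesis by (simp add: char_sum_0)
  next
    case False
    then obtain j where "a = \<omega> ^ j" using unit_group_generatorE[OF \<omega>] by blast
    also have "\<dots> = \<omega> ^ (j mod k + j div k * k)" by simp
    also have "\<dots> = \<omega> ^ (j mod k) * (\<omega> ^ (j div k)) ^ k" by (simp only: power_add power_mult)
    finally show ?thesis
      using that k nz char_sum_power_residues_mult[of "\<omega> ^ (j div k)" k "\<omega> ^ (j mod k)"] by simp
  qed
  thus ?thesis by (auto simp: period)
qed

theorem theorem4p1:
  fixes p m q k :: nat and \<omega> :: "'a::{field,finite}"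
  assumes "prime p" and "m \<ge> 1" and "q = p ^ m" and "CARD('a) = q"
    and "k \<ge> 1" and "k dvd q - 1"
    and "unit_group_generator \<omega>"
  shows "(integral_digraph (with_proj (gen_paley k :: 'a pair_pre_digraph))
             \<longleftrightarrow> k dvd (q - 1) div (p - 1))
       \<and> (k dvd (q - 1) div (p - 1)
             \<longleftrightarrow> (\<forall>i\<in>{0..k - 1}. gaussian_period p m \<omega> k i \<in> \<int>))
       \<and> (\<not> symmetric (with_proj (gen_paley k :: 'a pair_pre_digraph))
             \<longrightarrow> \<not> integral_digraph (with_proj (gen_paley k :: 'a pair_pre_digraph)))"
proof -
  have card: "CARD('a) = p ^ m" using assms by simp
  interpret nontrivial_character "trace_character p m :: 'a \<Rightarrow> complex"
    using nontrivial_trace_character[OF assms(1) card] .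
  define R where "R = (power_residues k :: 'a set)"
  have one: "1 \<in> R" unfolding R_def by (rule one_mem_power_residues)
  have sums: "(\<forall>a. char_sum R a \<in> \<int>) \<longleftrightarrow> prime_subfield p - {0} \<subseteq> R"
  proof
    assume "\<forall>a. char_sum R a \<in> \<int>"
    thus "prime_subfield p - {0} \<subseteq> R"
      using prime_subfield_subset_if_integral[OF assms(1) card _ one] by simp
  next
    assume "prime_subfield p - {0} \<subseteq> R"
    from integral_if_prime_subfield_subset[OF assms(1) card this]
    show "\<forall>a. char_sum R a \<in> \<int>" by (simp add: R_def power_residues_mult)
  qed
  have dvd: "prime_subfield p - {0} \<subseteq> R \<longleftrightarrow> k dvd (q - 1) div (p - 1)"
    using prime_subfield_subset_power_residues_iff[OF assms(1) card, of k \<omega>] assms by (simp add: R_def)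
  have graph: "integral_digraph (with_proj (gen_paley k :: 'a pair_pre_digraph))
      \<longleftrightarrow> (\<forall>a. char_sum R a \<in> \<int>)"
    by (simp add: gen_paley_def R_def integral_cayley_digraph_iff)
  have "{0..k - 1} = {i. i < k}" using assms(5) by auto
  hence periods: "(\<forall>a. char_sum R a \<in> \<int>) \<longleftrightarrow> (\<forall>i\<in>{0..k - 1}. gaussian_period p m \<omega> k i \<in> \<int>)"
    using integral_char_sums_power_residues_iff[of k \<omega>] assms
    by (simp add: R_def gaussian_period_def trace_character_def)
  have "symmetric (with_proj (gen_paley k :: 'a pair_pre_digraph))" if "prime_subfield p - {0} \<subseteq> R"
  proof -
    have "(-1 :: 'a) \<in> R" using that minus_one_mem_prime_subfield[OF assms(1) card] by auto
    hence "x \<in> R \<Longrightarrow> - x \<in> R" for x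
      using power_residues_mult[of "-1" k x] by (simp add: R_def)
    hence "v - u \<in> R \<Longrightarrow> u - v \<in> R" for u v by (metis minus_diff_eq)
    thus ?thesis
      by (auto simp: symmetric_def sym_def gen_paley_def cayley_digraph_def R_def)
  qed
  thus ?thesis using sums dvd graph periods by blast
qed

end
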